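(* Let $G=(V,E)$ be a finite graph (directed or undirected) with edge weights $w_{ij}\ge 0$ and internal opinions $s_i\in[0,1]$ for $i\in V$. Then the set function $T\mapsto g(\mathbf{z}\mid T)$, defined on subsets $T\subseteq V$, is monotone and submodular. That is, for all $T\subseteq T'\subseteq V$, $g(\mathbf{z}\mid T)\le g(\mathbf{z}\mid T')$, and for all $T\subseteq T'\subseteq V$ and every $j\in V\setminus T'$, $$g(\mathbf{z}\mid T'\cup\{j\})-g(\mathbf{z}\mid T')\le g(\mathbf{z}\mid T\cup\{j\})-g(\mathbf{z}\mid T).$$
   Context: For an edge-weighted finite graph $G=(V,E)$ write $N(i)=\{j:(i,j)\in E\}$ (with $w_{ij}=w_{ji}$ if $G$ is undirected). For $T\subseteq V$, the equilibrium vector $\mathbf{z}=(z_i)_{i\in V}$ with the expressed opinions of the nodes in $T$ fixed to $1$ is the unique vector satisfying $$z_i=1 \text{ for } i\in T,\qquad z_i=\frac{s_i+\sum_{j\in N(i)}w_{ij}z_j}{1+\sum_{j\in N(i)}w_{ij}} \text{ for } i\in V\setminus T.$$ The overall opinion is $g(\mathbf{z}\mid T)=\sum_{i\in V}z_i$ for this equilibrium vector; the sum includes the nodes of $T$. *)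

theory Defs
  imports Complex_Main "HOL-Library.FuncSet" "Graph_Theory.Graph_Theory"
begin

text \<open>
  A finite graph is a \<open>pair_fin_digraph\<close>, whose arcs are ordered pairs of vertices. An undirected
  graph is represented by listing both \<open>(i, j)\<close> and \<open>(j, i)\<close> for each edge, with
  \<open>w i j = w j i\<close>; it is thus a special case of a directed one.
\<close>

definition nbrs :: "'a pair_pre_digraph \<Rightarrow> 'a \<Rightarrow> 'a set" where
  "nbrs G i = {j. (i, j) \<in> parcs G}"

definition is_equilibrium ::
    "'a pair_pre_digraph \<Rightarrow> ('a \<Rightarrow> 'a \<Rightarrow> real) \<Rightarrow> ('a \<Rightarrow> real) \<Rightarrow> 'a set \<Rightarrow> ('a \<Rightarrow> real) \<Rightarrow> bool" where
  "is_equilibrium G w s T z \<longleftrightarrow>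
     (\<forall>i\<in>T. z i = 1) \<and>
     (\<forall>i\<in>pverts G - T. z i = (s i + (\<Sum>j\<in>nbrs G i. w i j * z j)) / (1 + (\<Sum>j\<in>nbrs G i. w i j)))"

text \<open>
  A vector indexed by the vertices is a function that is \<open>extensional\<close> on the vertex set;
  without this the values off the graph would be arbitrary and the description would
  not determine a unique function.
\<close>

definition equilibrium ::
    "'a pair_pre_digraph \<Rightarrow> ('a \<Rightarrow> 'a \<Rightarrow> real) \<Rightarrow> ('a \<Rightarrow> real) \<Rightarrow> 'a set \<Rightarrow> 'a \<Rightarrow> real" where
  "equilibrium G w s T = (THE z. z \<in> extensional (pverts G) \<and> is_equilibrium G w s T z)"

definition overall_opinion ::
    "'a pair_pre_digraph \<Rightarrow> ('a \<Rightarrow> 'a \<Rightarrow> real) \<Rightarrow> ('a \<Rightarrow> real) \<Rightarrow> 'a set \<Rightarrow> real" where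
  "overall_opinion G w s T = (\<Sum>i\<in>pverts G. equilibrium G w s T i)"

end

theory Submission
  imports Defs
begin

text \<open>
  Everything follows from a maximum principle: a function that is nonpositive at some vertices and
  at every other vertex \<open>i\<close> satisfies \<open>(1 + \<Sum>\<^sub>j w\<^sub>i\<^sub>j) u\<^sub>i \<le> \<Sum>\<^sub>j w\<^sub>i\<^sub>j u\<^sub>j\<close> is nonpositive, as one sees at a vertex
  where it is maximal. Uniqueness, the bound \<open>z \<le> 1\<close> and monotonicity come from applying it to
  suitable differences. For submodularity apply it to
  \<open>u = (z(T' \<union> {j}) - z(T')) - (z(T \<union> {j}) - z(T))\<close>, which is nonpositive on \<open>T'\<close> and at \<open>j\<close> by
  monotonicity and satisfies the homogeneous equation elsewhere; so the inequality even holds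
  at every vertex, not only for the sum. Existence of the equilibrium is obtained by
  iterating the averaging map from the zero vector, which gives a bounded increasing sequence.
\<close>

locale opinion_digraph = pair_fin_digraph G for G :: "'a pair_pre_digraph" +
  fixes w :: "'a \<Rightarrow> 'a \<Rightarrow> real" and s :: "'a \<Rightarrow> real"
  assumes w_nonneg: "(i, j) \<in> parcs G \<Longrightarrow> 0 \<le> w i j"
    and s_unit: "i \<in> pverts G \<Longrightarrow> s i \<in> {0..1}"
begin

text \<open>The summand 1 is the weight a vertex gives to its own internal opinion; it keeps the
  denominator positive even without neighbours.\<close>

abbreviation deg :: "'a \<Rightarrow> real" where
  "deg i \<equiv> 1 + (\<Sum>j\<in>nbrs G i. w i j)"

lemma nbrs_in_verts: "j \<in> nbrs G i \<Longrightarrow> j \<in> pverts G"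
  using in_arcsD2 by (auto simp: nbrs_def)

lemma w_nbrs_nonneg: "j \<in> nbrs G i \<Longrightarrow> 0 \<le> w i j"
  using w_nonneg by (auto simp: nbrs_def)

lemma deg_pos: "0 < deg i"
  using sum_nonneg[of "nbrs G i" "w i"] w_nbrs_nonneg by fastforce

lemma maximum_principle:
  assumes sub: "\<And>i. i \<in> pverts G \<Longrightarrow> u i \<le> 0 \<or> deg i * u i \<le> (\<Sum>j\<in>nbrs G i. w i j * u j)"
    and "i \<in> pverts G"
  shows "u i \<le> 0"
proof -
  obtain m where m: "m \<in> pverts G" "\<And>k. k \<in> pverts G \<Longrightarrow> u k \<le> u m"
  proof -
    have "Max (u ` pverts G) \<in> u ` pverts G"
      using \<open>i \<in> pverts G\<close> by (intro Max_in) auto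
    then obtain m where "m \<in> pverts G" "u m = Max (u ` pverts G)" by force
    then show ?thesis by (intro that[of m]) auto
  qed
  have "u m \<le> 0"
  proof (rule ccontr)
    assume "\<not> u m \<le> 0"
    then have "deg m * u m \<le> (\<Sum>j\<in>nbrs G m. w m j * u j)" using sub[OF m(1)] by simp
    also have "\<dots> \<le> (\<Sum>j\<in>nbrs G m. w m j * u m)"
      using m(2) nbrs_in_verts w_nbrs_nonneg by (intro sum_mono mult_left_mono) auto
    \<comment> \<open>The summand 1 in \<open>deg m\<close> leaves a surplus \<open>u m\<close>,
      which contradicts \<open>u m > 0\<close>.\<close>
    also have "\<dots> = deg m * u m - u m"
      by (simp add: sum_distrib_right distrib_right)
    finally show False using \<open>\<not> u m \<le> 0\<close> by simp
  qed
  then show ?thesis using m(2)[OF \<open>i \<in> pverts G\<close>] by simp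
qed

lemma is_equilibrium_fixed: "is_equilibrium G w s T z \<Longrightarrow> i \<in> T \<Longrightarrow> z i = 1"
  by (simp add: is_equilibrium_def)

lemma is_equilibrium_free:
  assumes "is_equilibrium G w s T z" "i \<in> pverts G" "i \<notin> T"
  shows "deg i * z i = s i + (\<Sum>j\<in>nbrs G i. w i j * z j)"
proof -
  have "z i = (s i + (\<Sum>j\<in>nbrs G i. w i j * z j)) / deg i"
    using assms by (simp add: is_equilibrium_def)
  then show ?thesis using deg_pos[of i] by (simp add: field_simps)
qed

text \<open>Since \<open>s i \<le> 1\<close>, the difference \<open>z - 1\<close> satisfies the
  inequality of \<open>maximum_principle\<close> off \<open>T\<close>, and it vanishes on
  \<open>T\<close>.\<close>

lemma is_equilibrium_le_1:
  assumes eq: "is_equilibrium G w s T z" and "i \<in> pverts G"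
  shows "z i \<le> 1"
proof -
  have "z i - 1 \<le> 0"
  proof (rule maximum_principle[OF _ \<open>i \<in> pverts G\<close>])
    fix i assume i: "i \<in> pverts G"
    show "z i - 1 \<le> 0 \<or> deg i * (z i - 1) \<le> (\<Sum>j\<in>nbrs G i. w i j * (z j - 1))"
    proof (cases "i \<in> T")
      case False
      have "deg i * (z i - 1) = (s i - 1) + (\<Sum>j\<in>nbrs G i. w i j * (z j - 1))"
        using is_equilibrium_free[OF eq i False] by (simp add: right_diff_distrib sum_subtractf)
      then show ?thesis using s_unit[OF i] by simp
    qed (simp add: is_equilibrium_fixed[OF eq])
  qed
  then show ?thesis by simp
qed

text \<open>On \<open>T'\<close> the larger vector is 1, an upper bound for every equilibrium; off
  \<open>T'\<close> both vectors satisfy the same equation, so \<open>s i\<close> cancels. The case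
  \<open>T = T'\<close> yields uniqueness.\<close>

lemma is_equilibrium_mono:
  assumes eq: "is_equilibrium G w s T z" and eq': "is_equilibrium G w s T' z'"
    and "T \<subseteq> T'" "i \<in> pverts G"
  shows "z i \<le> z' i"
proof -
  have "z i - z' i \<le> 0"
  proof (rule maximum_principle[OF _ \<open>i \<in> pverts G\<close>])
    fix i assume i: "i \<in> pverts G"
    show "z i - z' i \<le> 0 \<or> deg i * (z i - z' i) \<le> (\<Sum>j\<in>nbrs G i. w i j * (z j - z' j))"
    proof (cases "i \<in> T'")
      case True
      then show ?thesis
        using is_equilibrium_fixed[OF eq'] is_equilibrium_le_1[OF eq i] by simp
    next
      case False
      then have "i \<notin> T" using \<open>T \<subseteq> T'\<close> by blast
      then show ?thesis
        using False is_equilibrium_free[OF eq i] is_equilibrium_free[OF eq' i]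
        by (simp add: right_diff_distrib sum_subtractf)
    qed
  qed
  then show ?thesis by simp
qed

lemma is_equilibrium_submodular:
  assumes eq: "is_equilibrium G w s T z" "is_equilibrium G w s (T \<union> {k}) y"
    and eq': "is_equilibrium G w s T' z'" "is_equilibrium G w s (T' \<union> {k}) y'"
    and "T \<subseteq> T'" "i \<in> pverts G"
  shows "y' i - z' i \<le> y i - z i"
proof -
  have "(y' i - z' i) - (y i - z i) \<le> 0"
  proof (rule maximum_principle[OF _ \<open>i \<in> pverts G\<close>])
    fix i assume i: "i \<in> pverts G"
    consider "i \<in> T'" | "i = k" | "i \<notin> T' \<union> {k}" by blast
    then show "(y' i - z' i) - (y i - z i) \<le> 0 \<or>
      deg i * ((y' i - z' i) - (y i - z i)) \<le> (\<Sum>j\<in>nbrs G i. w i j * ((y' j - z' j) - (y j - z j)))"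
    proof cases
      case 1
      \<comment> \<open>On \<open>T'\<close> the increment of the larger set is zero, and that of
        the smaller set is nonnegative.\<close>
      then have "y' i = 1" "z' i = 1"
        using is_equilibrium_fixed eq' by auto
      moreover have "z i \<le> y i" using is_equilibrium_mono[OF eq _ i] by blast
      ultimately show ?thesis by simp
    next
      case 2
      \<comment> \<open>At \<open>k\<close> both enlarged sets fix the value 1, so the claim reduces
        to \<open>z i \<le> z' i\<close>.\<close>
      then have "y' i = 1" "y i = 1"
        using is_equilibrium_fixed[OF eq(2)] is_equilibrium_fixed[OF eq'(2)] by auto
      moreover have "z i \<le> z' i" using is_equilibrium_mono[OF eq(1) eq'(1) \<open>T \<subseteq> T'\<close> i] .
      ultimately show ?thesis by simp
    next
      case 3
      then have "i \<notin> T" "i \<notin> T \<union> {k}" "i \<notin> T'" using \<open>T \<subseteq> T'\<close> by auto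
      then show ?thesis
        using 3 is_equilibrium_free[OF eq(1) i] is_equilibrium_free[OF eq(2) i]
          is_equilibrium_free[OF eq'(1) i] is_equilibrium_free[OF eq'(2) i]
        by (simp add: right_diff_distrib sum_subtractf)
    qed
  qed
  then show ?thesis by simp
qed

text \<open>For \<open>T\<close> inside the vertex set, the equilibrium conditions say exactly that
  \<open>z\<close> agrees with \<open>averaging T z\<close> on the vertices.\<close>

definition averaging :: "'a set \<Rightarrow> ('a \<Rightarrow> real) \<Rightarrow> 'a \<Rightarrow> real" where
  "averaging T z i = (if i \<in> T then 1 else (s i + (\<Sum>j\<in>nbrs G i. w i j * z j)) / deg i)"

lemma averaging_mono:
  assumes "\<And>j. j \<in> pverts G \<Longrightarrow> x j \<le> y j"
  shows "averaging T x i \<le> averaging T y i"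
proof -
  have "(\<Sum>j\<in>nbrs G i. w i j * x j) \<le> (\<Sum>j\<in>nbrs G i. w i j * y j)"
    using assms nbrs_in_verts w_nbrs_nonneg by (intro sum_mono mult_left_mono) auto
  then show ?thesis
    using deg_pos[of i] by (auto simp: averaging_def intro: divide_right_mono)
qed

lemma averaging_zero_nonneg: "i \<in> pverts G \<Longrightarrow> 0 \<le> averaging T (\<lambda>_. 0) i"
  using s_unit[of i] deg_pos[of i] by (simp add: averaging_def)

lemma averaging_one_le: "i \<in> pverts G \<Longrightarrow> averaging T (\<lambda>_. 1) i \<le> 1"
  using s_unit[of i] deg_pos[of i] by (simp add: averaging_def)

lemma averaging_tendsto:
  assumes "\<And>j. j \<in> pverts G \<Longrightarrow> (\<lambda>n. X n j) \<longlonglongrightarrow> z j"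
  shows "(\<lambda>n. averaging T (X n) i) \<longlonglongrightarrow> averaging T z i"
proof (cases "i \<in> T")
  case False
  have "(\<lambda>n. (s i + (\<Sum>j\<in>nbrs G i. w i j * X n j)) / deg i)
      \<longlonglongrightarrow> (s i + (\<Sum>j\<in>nbrs G i. w i j * z j)) / deg i"
    using assms nbrs_in_verts deg_pos[of i] by (intro tendsto_intros) auto
  then show ?thesis using False by (simp add: averaging_def)
qed (simp add: averaging_def)

lemma ex_is_equilibrium:
  assumes "T \<subseteq> pverts G"
  shows "\<exists>z \<in> extensional (pverts G). is_equilibrium G w s T z"
proof -
  define X where "X n = (averaging T ^^ n) (\<lambda>_. 0)" for n
  have X_Suc: "X (Suc n) = averaging T (X n)" for n by (simp add: X_def)
  \<comment> \<open>The first step goes up because \<open>s\<close> is nonnegative. The induction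
    needs all vertices at once, as the value at \<open>i\<close> depends on the neighbours of
    \<open>i\<close>.\<close>
  have X_inc: "X n i \<le> X (Suc n) i" if "i \<in> pverts G" for n i
    using that
  proof (induction n arbitrary: i)
    case 0
    then show ?case using averaging_zero_nonneg by (simp add: X_def)
  next
    case (Suc n)
    then show ?case
      unfolding X_Suc[of n] X_Suc[of "Suc n"] by (intro averaging_mono)
  qed
  have X_le: "X n i \<le> 1" if "i \<in> pverts G" for n i
    using that
  proof (induction n arbitrary: i)
    case (Suc n)
    have "averaging T (X n) i \<le> averaging T (\<lambda>_. 1) i"
      using Suc.IH by (intro averaging_mono)
    then show ?case using averaging_one_le[OF Suc.prems, of T] by (simp add: X_Suc)
  qed (simp add: X_def)
  have "\<exists>l. (\<lambda>n. X n i) \<longlonglongrightarrow> l" if "i \<in> pverts G" for i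
  proof -
    have "incseq (\<lambda>n. X n i)" using X_inc[OF that] by (simp add: incseq_Suc_iff)
    then show ?thesis using incseq_convergent[of "\<lambda>n. X n i" 1] X_le[OF that] by blast
  qed
  then obtain z where z: "\<And>i. i \<in> pverts G \<Longrightarrow> (\<lambda>n. X n i) \<longlonglongrightarrow> z i" by metis
  \<comment> \<open>The shifted sequence tends both to \<open>z i\<close> and, by continuity of the
    averaging map, to \<open>averaging T z i\<close>.\<close>
  have fixpoint: "z i = averaging T z i" if "i \<in> pverts G" for i
  proof (rule LIMSEQ_unique)
    show "(\<lambda>n. X (Suc n) i) \<longlonglongrightarrow> z i" using z[OF that] by (rule LIMSEQ_Suc)
    show "(\<lambda>n. X (Suc n) i) \<longlonglongrightarrow> averaging T z i"
      unfolding X_Suc by (rule averaging_tendsto) (rule z)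
  qed
  \<comment> \<open>Making \<open>z\<close> extensional does not disturb the equations, since
    neighbours are vertices.\<close>
  have restrict: "(\<Sum>j\<in>nbrs G i. w i j * restrict z (pverts G) j) = (\<Sum>j\<in>nbrs G i. w i j * z j)" for i
    using nbrs_in_verts by (intro sum.cong) auto
  have "is_equilibrium G w s T (restrict z (pverts G))"
    unfolding is_equilibrium_def restrict
    using fixpoint assms by (auto simp: averaging_def subset_iff)
  then show ?thesis by blast
qed

text \<open>Existence and uniqueness justify the definite description, so the comparison lemmas
  apply to \<open>equilibrium\<close>.\<close>

lemma is_equilibrium_equilibrium:
  assumes "T \<subseteq> pverts G"
  shows "is_equilibrium G w s T (equilibrium G w s T)"
proof -
  have "\<exists>!z. z \<in> extensional (pverts G) \<and> is_equilibrium G w s T z"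
  proof (rule ex_ex1I)
    fix z z'
    assume "z \<in> extensional (pverts G) \<and> is_equilibrium G w s T z"
      and "z' \<in> extensional (pverts G) \<and> is_equilibrium G w s T z'"
    \<comment> \<open>Monotonicity with equal fixed sets, used in both directions, gives equality on
      the vertices.\<close>
    then show "z = z'"
      using is_equilibrium_mono by (intro extensionalityI[of z "pverts G" z'] order_antisym) blast+
  qed (use ex_is_equilibrium[OF assms] in blast)
  from theI'[OF this] show ?thesis by (simp add: equilibrium_def)
qed

lemma overall_opinion_mono:
  assumes "T \<subseteq> T'" "T' \<subseteq> pverts G"
  shows "overall_opinion G w s T \<le> overall_opinion G w s T'"
  unfolding overall_opinion_def
  using assms
  by (intro sum_mono is_equilibrium_mono[where T = T and T' = T'] is_equilibrium_equilibrium) auto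

lemma overall_opinion_submodular:
  assumes "T \<subseteq> T'" "T' \<subseteq> pverts G" "k \<in> pverts G"
  shows "overall_opinion G w s (T' \<union> {k}) - overall_opinion G w s T'
    \<le> overall_opinion G w s (T \<union> {k}) - overall_opinion G w s T"
  \<comment> \<open>Merging each difference of sums into one sum allows a comparison vertex by
    vertex.\<close>
  unfolding overall_opinion_def sum_subtractf[symmetric]
  using assms
  by (intro sum_mono is_equilibrium_submodular[where T = T and T' = T' and k = k]
      is_equilibrium_equilibrium) auto

end

theorem theorem4p2:
  fixes G :: "'a pair_pre_digraph"
    and w :: "'a \<Rightarrow> 'a \<Rightarrow> real"
    and s :: "'a \<Rightarrow> real"
  assumes "pair_fin_digraph G"
    and "\<And>i j. (i, j) \<in> parcs G \<Longrightarrow> 0 \<le> w i j"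
    and "\<And>i. i \<in> pverts G \<Longrightarrow> s i \<in> {0..1}"
  shows "(\<forall>T T'. T \<subseteq> T' \<and> T' \<subseteq> pverts G \<longrightarrow>
            overall_opinion G w s T \<le> overall_opinion G w s T') \<and>
         (\<forall>T T'. T \<subseteq> T' \<and> T' \<subseteq> pverts G \<longrightarrow> (\<forall>j\<in>pverts G - T'.
            overall_opinion G w s (T' \<union> {j}) - overall_opinion G w s T'
              \<le> overall_opinion G w s (T \<union> {j}) - overall_opinion G w s T))"
proof -
  interpret opinion_digraph G w s
    using assms by (intro opinion_digraph.intro opinion_digraph_axioms.intro)
  show ?thesis using overall_opinion_mono overall_opinion_submodular by blast
qed

end
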